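(* For any poloid $P$ there is a poloid action $\alpha:P\rightarrow\alpha(P)\subseteq\overline{\mathscr{F}}_P$, $x\mapsto\alpha(x)$, of $P$ on (the underlying set of) $P$ such that $\alpha$ is a poloid isomorphism from $P$ onto $\alpha(P)$ and $\alpha(P)$ equipped with $\circ$ is a transformation poloid.
   Context: A (partial) magma is a non-empty set $P$ with a partial binary operation $(x,y)\mapsto xy$, i.e. a function from some non-empty subset of $P\times P$ to $P$; "$xy$ is defined" means that $(x,y)$ lies in that subset. A compound expression is defined when all its successive products are: $(xy)z$ is defined iff $xy$ is defined and the product of $xy$ with $z$ is defined; similarly for $x(yz)$. A semigroupoid is a magma $P$ such that for all $x,y,z\in P$: if (a) $xy$ and $yz$ are both defined, or (b) $x(yz)$ is defined, or (c) $(xy)z$ is defined, then $(xy)z$ and $x(yz)$ are both defined and $(xy)z=x(yz)$. A unit in a magma $P$ is an $e\in P$ such that $ex=x$ for all $x$ for which $ex$ is defined and $xe=x$ for all $x$ for which $xe$ is defined. A poloid is a semigroupoid $P$ such that for every $x\in P$ there are units $\epsilon_x,\varepsilon_x\in P$ such that $\epsilon_x x$ and $x\varepsilon_x$ are defined. A transformation $f$ on a set $X$ consists of a subset $\mathrm{dom}(f)\subseteq X$, a rule assigning to each $x\in\mathrm{dom}(f)$ exactly one $f(x)\in X$, and a subset $\mathrm{cod}(f)\subseteq X$ with $\mathrm{im}(f)=\{f(x)\mid x\in\mathrm{dom}(f)\}\subseteq\mathrm{cod}(f)$. Two transformations are equal iff they have the same domain, codomain and values. It is non-empty if $\mathrm{dom}(f)\neq\emptyset$.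 For $S\subseteq X$, the identity transformation $Id_S$ has $\mathrm{dom}(Id_S)=\mathrm{cod}(Id_S)=S$ and $Id_S(x)=x$ for $x\in S$. A transformation magma on $X$ is a set $\mathscr{F}_X$ of non-empty transformations on $X$ that is a magma under the partial operation $\circ$, where $f\circ g$ is defined iff $\mathrm{dom}(f)\supseteq\mathrm{im}(g)$, and then $\mathrm{dom}(f\circ g)=\mathrm{dom}(g)$, $\mathrm{cod}(f\circ g)=\mathrm{cod}(f)$, $(f\circ g)(x)=f(g(x))$ for $x\in\mathrm{dom}(g)$ (in particular, $f\circ g\in\mathscr{F}_X$ whenever $f,g\in\mathscr{F}_X$ and $f\circ g$ is defined). $\overline{\mathscr{F}}_X$ is the transformation magma of all non-empty transformations on $X$. A transformation semigroupoid on $X$ is a transformation magma $\mathscr{F}_X$ on $X$ such that for all $f,g\in\mathscr{F}_X$, if $\mathrm{dom}(f)\supseteq\mathrm{im}(g)$ then $\mathrm{dom}(f)=\mathrm{cod}(g)$. A transformation poloid on $X$ is a transformation semigroupoid $\mathscr{S}_X$ on $X$ such that if $f\in\mathscr{S}_X$ then $Id_{\mathrm{dom}(f)},Id_{\mathrm{cod}(f)}\in\mathscr{S}_X$. A poloid homomorphism from a poloid $P$ to a poloid $Q$ is a total function $\phi:P\to Q$ such that (1) if $xy$ is defined then $\phi(x)\phi(y)$ is defined and $\phi(xy)=\phi(x)\phi(y)$; (2) if $e$ is a unit in $P$ then $\phi(e)$ is a unit in $Q$. A poloid isomorphism is a poloid homomorphism whose inverse function exists and is a poloid homomorphism. A poloid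 action of a poloid $P$ on a set $X$ is a total function $\alpha:P\to\alpha(P)\subseteq\overline{\mathscr{F}}_X$ which is a poloid homomorphism (onto the poloid $\alpha(P)$ with operation $\circ$) such that if $e\in P$ is a unit then $\alpha(e)$ is the identity transformation $Id_{\mathrm{dom}(\alpha(e))}$. *)

theory Defs
  imports Main "HOL-Library.FuncSet"
begin

(* A partial operation on P is a function into the option type: "x y is defined" means
   mult x y \<noteq> None.  Values of mult at arguments outside P are unconstrained and never used;
   the partial operation meant is the restriction of mult to P \<times> P. *)
locale partial_magma =
  fixes P :: "'a set" and mult :: "'a \<Rightarrow> 'a \<Rightarrow> 'a option"
  assumes carrier_nonempty: "P \<noteq> {}"
    and domain_nonempty: "\<exists>x\<in>P. \<exists>y\<in>P. mult x y \<noteq> None"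
    and closed: "\<lbrakk>x \<in> P; y \<in> P; mult x y = Some z\<rbrakk> \<Longrightarrow> z \<in> P"

definition mult_left :: "('a \<Rightarrow> 'a \<Rightarrow> 'a option) \<Rightarrow> 'a \<Rightarrow> 'a \<Rightarrow> 'a \<Rightarrow> 'a option" where
  "mult_left mult x y z = Option.bind (mult x y) (\<lambda>u. mult u z)" (* (x y) z *)

definition mult_right :: "('a \<Rightarrow> 'a \<Rightarrow> 'a option) \<Rightarrow> 'a \<Rightarrow> 'a \<Rightarrow> 'a \<Rightarrow> 'a option" where
  "mult_right mult x y z = Option.bind (mult y z) (\<lambda>u. mult x u)" (* x (y z) *)

locale semigroupoid = partial_magma +
  assumes assoc:
    "\<lbrakk>x \<in> P; y \<in> P; z \<in> P;
      (mult x y \<noteq> None \<and> mult y z \<noteq> None)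
        \<or> mult_right mult x y z \<noteq> None \<or> mult_left mult x y z \<noteq> None\<rbrakk>
     \<Longrightarrow> mult_left mult x y z \<noteq> None \<and> mult_right mult x y z \<noteq> None
         \<and> mult_left mult x y z = mult_right mult x y z"

definition magma_unit :: "'a set \<Rightarrow> ('a \<Rightarrow> 'a \<Rightarrow> 'a option) \<Rightarrow> 'a \<Rightarrow> bool" where
  "magma_unit P mult e \<longleftrightarrow> e \<in> P
     \<and> (\<forall>x\<in>P. mult e x \<noteq> None \<longrightarrow> mult e x = Some x)
     \<and> (\<forall>x\<in>P. mult x e \<noteq> None \<longrightarrow> mult x e = Some x)"

locale poloid = semigroupoid +
  assumes left_unit: "x \<in> P \<Longrightarrow> \<exists>e. magma_unit P mult e \<and> mult e x \<noteq> None"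
    and right_unit: "x \<in> P \<Longrightarrow> \<exists>e. magma_unit P mult e \<and> mult x e \<noteq> None"

locale poloid_hom =
  source: poloid P mult + target: poloid Q mult'
  for P :: "'a set" and mult :: "'a \<Rightarrow> 'a \<Rightarrow> 'a option"
    and Q :: "'b set" and mult' :: "'b \<Rightarrow> 'b \<Rightarrow> 'b option" +
  fixes \<phi> :: "'a \<Rightarrow> 'b"
  assumes maps_to: "\<phi> \<in> P \<rightarrow> Q"
    and hom_mult: "\<lbrakk>x \<in> P; y \<in> P; mult x y = Some z\<rbrakk> \<Longrightarrow> mult' (\<phi> x) (\<phi> y) = Some (\<phi> z)"
    and hom_unit: "magma_unit P mult e \<Longrightarrow> magma_unit Q mult' (\<phi> e)"

locale poloid_iso = poloid_hom +
  assumes bij: "bij_betw \<phi> P Q"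
    and inverse_hom: "poloid_hom Q mult' P mult (inv_into P \<phi>)"

(* A transformation is a partial map together with a codomain; the domain and the image are
   dom (tmap f) and ran (tmap f).  Record equality is then equality of domains, codomains
   and values. *)
record 'a transformation =
  tmap :: "'a \<rightharpoonup> 'a"
  tcod :: "'a set"

abbreviation tdom :: "'a transformation \<Rightarrow> 'a set" where
  "tdom f \<equiv> dom (tmap f)"

abbreviation tim :: "'a transformation \<Rightarrow> 'a set" where
  "tim f \<equiv> ran (tmap f)"

definition transformation_on :: "'a set \<Rightarrow> 'a transformation \<Rightarrow> bool" where
  "transformation_on X f \<longleftrightarrow> tdom f \<subseteq> X \<and> tcod f \<subseteq> X \<and> tim f \<subseteq> tcod f"

definition nonempty_transformations :: "'a set \<Rightarrow> 'a transformation set" where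
  "nonempty_transformations X = {f. transformation_on X f \<and> tdom f \<noteq> {}}"

definition tid :: "'a set \<Rightarrow> 'a transformation" where
  "tid S = \<lparr>tmap = Some |` S, tcod = S\<rparr>"

definition tcomp :: "'a transformation \<Rightarrow> 'a transformation \<Rightarrow> 'a transformation option" where
  "tcomp f g =
     (if tim g \<subseteq> tdom f then Some \<lparr>tmap = tmap f \<circ>\<^sub>m tmap g, tcod = tcod f\<rparr> else None)"

locale transformation_magma = partial_magma F tcomp
  for X :: "'a set" and F :: "'a transformation set" +
  assumes transformations: "F \<subseteq> nonempty_transformations X"

locale transformation_semigroupoid = transformation_magma +
  assumes dom_eq_cod: "\<lbrakk>f \<in> F; g \<in> F; tim g \<subseteq> tdom f\<rbrakk> \<Longrightarrow> tdom f = tcod g"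

locale transformation_poloid = transformation_semigroupoid +
  assumes identities: "f \<in> F \<Longrightarrow> tid (tdom f) \<in> F \<and> tid (tcod f) \<in> F"

locale poloid_action =
  poloid_hom P mult "\<alpha> ` P" tcomp \<alpha>
  for P :: "'a set" and mult :: "'a \<Rightarrow> 'a \<Rightarrow> 'a option"
    and X :: "'b set" and \<alpha> :: "'a \<Rightarrow> 'b transformation" +
  assumes range_transformations: "\<alpha> ` P \<subseteq> nonempty_transformations X"
    and unit_identity: "magma_unit P mult e \<Longrightarrow> \<alpha> e = tid (tdom (\<alpha> e))"

end

theory Submission
  imports Defs
begin

text \<open>
  As in Cayley's theorem, \<open>x\<close> acts by left multiplication \<open>t \<mapsto> x t\<close>. Every \<open>x\<close> has a unique left
  unit and a unique right unit, and \<open>x y\<close> is defined iff the right unit of \<open>x\<close> is the left unit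
  of \<open>y\<close>. Hence the domain of left multiplication by \<open>x\<close> consists of the elements whose left unit
  is the right unit of \<open>x\<close>; as codomain one takes the elements whose left unit is that of \<open>x\<close>, so
  that composability of left multiplications, equality of domain and codomain, and definedness of
  the product in \<open>P\<close> all coincide. Injectivity follows by evaluating at the right unit.
\<close>

section \<open>Transport of poloid structure along a map\<close>

text \<open>The equation with \<open>map_option\<close> makes the map reflect definedness as well as
  preserve it, so every law on the image can be checked on arbitrarily chosen preimages.\<close>

lemma poloid_hom_image:
  assumes "poloid P mult"
    and mult': "\<And>x y. \<lbrakk>x \<in> P; y \<in> P\<rbrakk> \<Longrightarrow> mult' (\<phi> x) (\<phi> y) = map_option \<phi> (mult x y)"
  shows "poloid_hom P mult (\<phi> ` P) mult' \<phi>"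
proof -
  interpret poloid P mult by fact
  have left: "mult_left mult' (\<phi> x) (\<phi> y) (\<phi> z) = map_option \<phi> (mult_left mult x y z)"
    if "x \<in> P" "y \<in> P" "z \<in> P" for x y z
    using that closed[of x y] by (cases "mult x y") (simp_all add: mult_left_def mult')
  have right: "mult_right mult' (\<phi> x) (\<phi> y) (\<phi> z) = map_option \<phi> (mult_right mult x y z)"
    if "x \<in> P" "y \<in> P" "z \<in> P" for x y z
    using that closed[of y z] by (cases "mult y z") (simp_all add: mult_right_def mult')
  have unit: "magma_unit (\<phi> ` P) mult' (\<phi> e)" if "magma_unit P mult e" for e
  proof -
    have e: "e \<in> P" using that by (simp add: magma_unit_def)
    \<comment> \<open>The unit law is put as a disjunction because \<open>map_option\<close> carries
      each of the two alternatives over to the image.\<close>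
    have *: "mult' (\<phi> e) y = None \<or> mult' (\<phi> e) y = Some y"
      "mult' y (\<phi> e) = None \<or> mult' y (\<phi> e) = Some y" if y: "y \<in> \<phi> ` P" for y
    proof -
      obtain x where x: "x \<in> P" "y = \<phi> x" using y by (rule imageE)
      have "mult e x = None \<or> mult e x = Some x" "mult x e = None \<or> mult x e = Some x"
        using x(1) \<open>magma_unit P mult e\<close> unfolding magma_unit_def by blast+
      then show "mult' (\<phi> e) y = None \<or> mult' (\<phi> e) y = Some y"
        "mult' y (\<phi> e) = None \<or> mult' y (\<phi> e) = Some y"
        unfolding x(2) mult'[OF e x(1)] mult'[OF x(1) e] by (elim disjE, simp_all)+
    qed
    show ?thesis
      unfolding magma_unit_def
    proof (intro conjI ballI impI)
      show "\<phi> e \<in> \<phi> ` P" using e by (rule imageI)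
    qed (use * in metis)+
  qed
  show ?thesis
  proof
    show "\<phi> ` P \<noteq> {}" using carrier_nonempty by simp
    show "\<exists>x\<in>\<phi> ` P. \<exists>y\<in>\<phi> ` P. mult' x y \<noteq> None"
      using domain_nonempty by (simp add: mult' del: not_None_eq)
    show "z \<in> \<phi> ` P" if xyz: "x \<in> \<phi> ` P" "y \<in> \<phi> ` P" "mult' x y = Some z" for x y z
    proof -
      obtain a b where ab: "a \<in> P" "b \<in> P" "x = \<phi> a" "y = \<phi> b" using xyz by blast
      then obtain c where "mult a b = Some c" "z = \<phi> c" using xyz(3) by (auto simp: mult')
      then show ?thesis using closed[OF ab(1,2)] by simp
    qed
  next
    fix x y z
    assume "x \<in> \<phi> ` P" "y \<in> \<phi> ` P" "z \<in> \<phi> ` P"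
      and defd: "mult' x y \<noteq> None \<and> mult' y z \<noteq> None
        \<or> mult_right mult' x y z \<noteq> None \<or> mult_left mult' x y z \<noteq> None"
    then obtain a b c where abc: "a \<in> P" "b \<in> P" "c \<in> P" "x = \<phi> a" "y = \<phi> b" "z = \<phi> c"
      by blast
    \<comment> \<open>By \<open>left\<close>, \<open>right\<close> and \<open>mult'\<close>, each of
      the three alternatives in \<open>defd\<close> turns into the same alternative for the
      preimages.\<close>
    show "mult_left mult' x y z \<noteq> None \<and> mult_right mult' x y z \<noteq> None
        \<and> mult_left mult' x y z = mult_right mult' x y z"
      using defd assoc[OF abc(1-3)] unfolding abc(4-6)
      by (simp only: left right mult' abc(1-3) option.map_disc_iff) simp
  next
    show "\<exists>e. magma_unit (\<phi> ` P) mult' e \<and> mult' e x \<noteq> None" if x: "x \<in> \<phi> ` P" for x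
    proof -
      obtain a where a: "a \<in> P" "x = \<phi> a" using x by blast
      obtain e where e: "magma_unit P mult e" "mult e a \<noteq> None" using left_unit a by blast
      then have "e \<in> P" by (simp add: magma_unit_def)
      then show ?thesis using unit[OF e(1)] e a by (intro exI[of _ "\<phi> e"]) (simp add: mult')
    qed
    show "\<exists>e. magma_unit (\<phi> ` P) mult' e \<and> mult' x e \<noteq> None" if x: "x \<in> \<phi> ` P" for x
    proof -
      obtain a where a: "a \<in> P" "x = \<phi> a" using x by blast
      obtain e where e: "magma_unit P mult e" "mult a e \<noteq> None" using right_unit a by blast
      then have "e \<in> P" by (simp add: magma_unit_def)
      then show ?thesis using unit[OF e(1)] e a by (intro exI[of _ "\<phi> e"]) (simp add: mult')
    qed
    show "\<phi> \<in> P \<rightarrow> \<phi> ` P" by blast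
    show "mult' (\<phi> x) (\<phi> y) = Some (\<phi> z)" if "x \<in> P" "y \<in> P" "mult x y = Some z" for x y z
      using that by (simp add: mult')
  qed (fact unit)
qed

text \<open>The inverse map satisfies an equation of the same form, so
  \<open>poloid_hom_image\<close> applies a second time, from the image back to
  \<open>P\<close>.\<close>

lemma poloid_iso_image:
  assumes "poloid P mult" and inj: "inj_on \<phi> P"
    and mult': "\<And>x y. \<lbrakk>x \<in> P; y \<in> P\<rbrakk> \<Longrightarrow> mult' (\<phi> x) (\<phi> y) = map_option \<phi> (mult x y)"
  shows "poloid_iso P mult (\<phi> ` P) mult' \<phi>"
proof -
  interpret poloid_hom P mult "\<phi> ` P" mult' \<phi> by (rule poloid_hom_image) fact+
  have "poloid_hom (\<phi> ` P) mult' (inv_into P \<phi> ` \<phi> ` P) mult (inv_into P \<phi>)"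
  proof (rule poloid_hom_image)
    show "poloid (\<phi> ` P) mult'" by unfold_locales
    show "mult (inv_into P \<phi> x) (inv_into P \<phi> y) = map_option (inv_into P \<phi>) (mult' x y)"
      if xy: "x \<in> \<phi> ` P" "y \<in> \<phi> ` P" for x y
    proof -
      obtain a b where ab: "a \<in> P" "b \<in> P" "x = \<phi> a" "y = \<phi> b" using xy by blast
      then show ?thesis
        using inj source.closed[of a b] by (cases "mult a b") (auto simp: mult' inv_into_f_f)
    qed
  qed
  moreover have "inv_into P \<phi> ` \<phi> ` P = P"
    using inj by (simp add: inv_into_image_cancel)
  ultimately have "poloid_hom (\<phi> ` P) mult' P mult (inv_into P \<phi>)" by simp
  moreover have "bij_betw \<phi> P (\<phi> ` P)" using inj by (rule inj_on_imp_bij_betw)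
  ultimately show ?thesis by intro_locales (rule poloid_iso_axioms.intro)
qed

section \<open>Left and right units of elements\<close>

context poloid
begin

text \<open>For elements of \<open>P\<close> the choice made by \<open>SOME\<close> is immaterial,
  by \<open>lunit_unique\<close>; likewise for \<open>runit\<close>.\<close>

definition lunit :: "'a \<Rightarrow> 'a" where
  "lunit x = (SOME e. magma_unit P mult e \<and> mult e x \<noteq> None)"

definition runit :: "'a \<Rightarrow> 'a" where
  "runit x = (SOME e. magma_unit P mult e \<and> mult x e \<noteq> None)"

lemma unit_in: "magma_unit P mult e \<Longrightarrow> e \<in> P"
  by (simp add: magma_unit_def)

lemma lunit:
  assumes "x \<in> P"
  shows "magma_unit P mult (lunit x)" "lunit x \<in> P" "mult (lunit x) x = Some x"
proof -
  have *: "magma_unit P mult (lunit x) \<and> mult (lunit x) x \<noteq> None"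
    unfolding lunit_def using left_unit[OF assms] by (rule someI_ex)
  then show "magma_unit P mult (lunit x)" ..
  then show "lunit x \<in> P" by (rule unit_in)
  show "mult (lunit x) x = Some x" using * assms unfolding magma_unit_def by blast
qed

lemma runit:
  assumes "x \<in> P"
  shows "magma_unit P mult (runit x)" "runit x \<in> P" "mult x (runit x) = Some x"
proof -
  have *: "magma_unit P mult (runit x) \<and> mult x (runit x) \<noteq> None"
    unfolding runit_def using right_unit[OF assms] by (rule someI_ex)
  then show "magma_unit P mult (runit x)" ..
  then show "runit x \<in> P" by (rule unit_in)
  show "mult x (runit x) = Some x" using * assms unfolding magma_unit_def by blast
qed

text \<open>A defined product of two units equals each of its factors.\<close>

lemma units_eq:
  assumes "magma_unit P mult e" "magma_unit P mult e'" "mult e e' \<noteq> None"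
  shows "e = e'"
  using assms unfolding magma_unit_def by (metis option.inject)

text \<open>Replacing \<open>x\<close> by its product with \<open>lunit x\<close> and regrouping
  shows that \<open>e\<close> and \<open>lunit x\<close> have a defined product, so
  \<open>units_eq\<close> applies.\<close>

lemma lunit_unique:
  assumes "x \<in> P" "magma_unit P mult e" "mult e x \<noteq> None"
  shows "lunit x = e"
proof -
  have "mult_right mult e (lunit x) x \<noteq> None"
    using assms lunit by (simp add: mult_right_def)
  then have "mult_left mult e (lunit x) x \<noteq> None"
    using assoc assms unit_in lunit by blast
  then have "mult e (lunit x) \<noteq> None" by (auto simp: mult_left_def bind_eq_Some_conv)
  then show ?thesis using units_eq assms lunit by metis
qed

lemma runit_unique:
  assumes "x \<in> P" "magma_unit P mult e" "mult x e \<noteq> None"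
  shows "runit x = e"
proof -
  have "mult_left mult x (runit x) e \<noteq> None"
    using assms runit by (simp add: mult_left_def)
  then have "mult_right mult x (runit x) e \<noteq> None"
    using assoc assms unit_in runit by blast
  then have "mult (runit x) e \<noteq> None" by (auto simp: mult_right_def bind_eq_Some_conv)
  then show ?thesis using units_eq assms runit by metis
qed

lemma unit_self:
  assumes "magma_unit P mult e"
  shows "lunit e = e" "runit e = e"
  using assms lunit runit unit_in units_eq by (metis option.distinct(1))+

text \<open>Inserting \<open>runit x\<close> between the factors and regrouping makes it a unit
  acting on \<open>y\<close> from the left, hence the left unit of \<open>y\<close>.\<close>

lemma mult_defined_iff:
  assumes "x \<in> P" "y \<in> P"
  shows "mult x y \<noteq> None \<longleftrightarrow> lunit y = runit x"
proof
  assume "mult x y \<noteq> None"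
  then have "mult_left mult x (runit x) y \<noteq> None"
    using assms runit by (simp add: mult_left_def)
  then have "mult_right mult x (runit x) y \<noteq> None"
    using assoc assms runit by blast
  then have "mult (runit x) y \<noteq> None" by (auto simp: mult_right_def bind_eq_Some_conv)
  then show "lunit y = runit x" using lunit_unique assms runit by metis
next
  assume "lunit y = runit x"
  then have "mult (runit x) y \<noteq> None" using lunit[OF assms(2)] by simp
  moreover have "mult x (runit x) \<noteq> None" using assms runit by simp
  \<comment> \<open>This uses the alternative of associativity in which both adjacent products are
    defined.\<close>
  ultimately have "mult_left mult x (runit x) y \<noteq> None"
    using assoc assms runit by blast
  then show "mult x y \<noteq> None" using assms runit by (simp add: mult_left_def)
qed

lemma mult_assoc:
  assumes "x \<in> P" "y \<in> P" "z \<in> P" "mult x y = Some u" "mult y z = Some v"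
  shows "mult u z = mult x v" "mult u z \<noteq> None"
  using assoc[OF assms(1-3)] assms(4,5) by (simp_all add: mult_left_def mult_right_def)

text \<open>Regrouping the product of \<open>lunit x\<close>, \<open>x\<close> and \<open>y\<close>
  shows that \<open>lunit x\<close> also acts on \<open>z\<close>; uniqueness does the rest.\<close>

lemma lunit_mult:
  assumes "x \<in> P" "y \<in> P" "mult x y = Some z"
  shows "lunit z = lunit x"
proof (rule lunit_unique)
  show "z \<in> P" using closed assms by blast
  show "magma_unit P mult (lunit x)" by (rule lunit) fact
  show "mult (lunit x) z \<noteq> None"
    using mult_assoc[of "lunit x" x y x z] assms lunit[of x] by metis
qed

lemma runit_mult:
  assumes "x \<in> P" "y \<in> P" "mult x y = Some z"
  shows "runit z = runit y"
proof (rule runit_unique)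
  show "z \<in> P" using closed assms by blast
  show "magma_unit P mult (runit y)" by (rule runit) fact
  show "mult z (runit y) \<noteq> None"
    using mult_assoc[of x y "runit y" z y] assms runit[of y] by metis
qed

section \<open>Left multiplications as transformations\<close>

text \<open>The restriction discards the unconstrained values of \<open>mult\<close> outside
  \<open>P\<close>. The codomain depends only on \<open>lunit x\<close> and may exceed the
  image.\<close>

definition left_mult :: "'a \<Rightarrow> 'a transformation" where
  "left_mult x = \<lparr>tmap = mult x |` P, tcod = {t \<in> P. lunit t = lunit x}\<rparr>"

lemma tdom_left_mult: "x \<in> P \<Longrightarrow> tdom (left_mult x) = {t \<in> P. lunit t = runit x}"
  using mult_defined_iff[of x]
  by (auto simp del: not_None_eq simp: left_mult_def restrict_map_def dom_def split: if_splits)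

lemma runit_in_tdom: "x \<in> P \<Longrightarrow> runit x \<in> tdom (left_mult x)"
  by (simp add: tdom_left_mult runit unit_self)

lemma in_tim_left_mult:
  assumes "x \<in> P"
  shows "x \<in> tim (left_mult x)"
proof (rule ranI)
  show "tmap (left_mult x) (runit x) = Some x"
    using runit[OF assms] by (simp add: left_mult_def)
qed

lemma tim_left_mult:
  assumes "x \<in> P"
  shows "tim (left_mult x) \<subseteq> tcod (left_mult x)"
proof
  fix z assume "z \<in> tim (left_mult x)"
  then obtain t where t: "t \<in> P" "mult x t = Some z"
    by (auto simp: left_mult_def ran_def restrict_map_def split: if_splits)
  show "z \<in> tcod (left_mult x)"
    using closed[OF assms t] lunit_mult[OF assms t] by (simp add: left_mult_def)
qed

lemma left_mult_nonempty_transformation: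
  assumes "x \<in> P"
  shows "left_mult x \<in> nonempty_transformations P"
proof -
  have "tcod (left_mult x) \<subseteq> P" by (auto simp: left_mult_def)
  moreover have "tdom (left_mult x) \<subseteq> P" using assms by (auto simp: tdom_left_mult)
  moreover have "tdom (left_mult x) \<noteq> {}" using runit_in_tdom[OF assms] by blast
  ultimately show ?thesis
    unfolding nonempty_transformations_def transformation_on_def
    using tim_left_mult[OF assms] by blast
qed

text \<open>Testing the inclusion at the single point \<open>y\<close> of the image already gives
  equality of the units; conversely, that equality makes codomain and domain coincide.\<close>

lemma tim_subset_tdom_iff:
  assumes "x \<in> P" "y \<in> P"
  shows "tim (left_mult y) \<subseteq> tdom (left_mult x) \<longleftrightarrow> lunit y = runit x"
proof
  assume "tim (left_mult y) \<subseteq> tdom (left_mult x)"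
  then show "lunit y = runit x"
    using in_tim_left_mult[OF assms(2)] tdom_left_mult[OF assms(1)] by blast
next
  assume "lunit y = runit x"
  then have "tcod (left_mult y) = tdom (left_mult x)"
    unfolding tdom_left_mult[OF assms(1)] by (simp add: left_mult_def)
  then show "tim (left_mult y) \<subseteq> tdom (left_mult x)"
    using tim_left_mult[OF assms(2)] by simp
qed

text \<open>Both sides are defined exactly when \<open>lunit y = runit x\<close>, and then
  associativity gives equal values. This is the equation that \<open>poloid_iso_image\<close> asks
  for.\<close>

lemma tcomp_left_mult:
  assumes "x \<in> P" "y \<in> P"
  shows "tcomp (left_mult x) (left_mult y) = map_option left_mult (mult x y)"
proof (cases "mult x y")
  case None
  then have "\<not> tim (left_mult y) \<subseteq> tdom (left_mult x)"
    using mult_defined_iff[OF assms] tim_subset_tdom_iff[OF assms] by blast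
  then show ?thesis using None by (simp add: tcomp_def)
next
  case (Some z)
  then have z: "z \<in> P" using closed assms by blast
  have "tim (left_mult y) \<subseteq> tdom (left_mult x)"
    using Some assms mult_defined_iff tim_subset_tdom_iff by (metis option.distinct(1))
  moreover have "(tmap (left_mult x) \<circ>\<^sub>m tmap (left_mult y)) t = tmap (left_mult z) t" for t
  proof (cases "t \<in> P")
    case t: True
    show ?thesis
    proof (cases "mult y t")
      \<comment> \<open>Since \<open>runit z = runit y\<close>, the products of \<open>z\<close> and
        of \<open>y\<close> with \<open>t\<close> are undefined together.\<close>
      case None
      then have "mult z t = None"
        using mult_defined_iff runit_mult[OF assms Some] t z assms by metis
      then show ?thesis using None by (simp add: left_mult_def map_comp_def t)
    next
      case (Some v)
      then have "v \<in> P" using closed assms t by blast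
      then show ?thesis
        using mult_assoc(1)[OF assms t \<open>mult x y = Some z\<close> Some] Some t
        by (simp add: left_mult_def map_comp_def)
    qed
  qed (simp add: left_mult_def map_comp_def)
  moreover have "tcod (left_mult x) = tcod (left_mult z)"
    using lunit_mult[OF assms Some] by (simp add: left_mult_def)
  ultimately show ?thesis
    using Some by (simp add: tcomp_def fun_eq_iff)
qed

lemma inj_on_left_mult: "inj_on left_mult P"
proof (rule inj_onI)
  fix x y assume xy: "x \<in> P" "y \<in> P" "left_mult x = left_mult y"
  \<comment> \<open>Equal maps have equal domains; as \<open>runit x\<close> is its own left unit,
    this forces the right units of \<open>x\<close> and \<open>y\<close> to agree before
    evaluation.\<close>
  have "runit x \<in> tdom (left_mult y)"
    using runit_in_tdom[OF xy(1)] unfolding xy(3) .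
  then have "lunit (runit x) = runit y"
    unfolding tdom_left_mult[OF xy(2)] by simp
  then have eq: "runit x = runit y"
    using unit_self(1)[OF runit(1)[OF xy(1)]] by metis
  have "tmap (left_mult x) (runit y) = tmap (left_mult y) (runit y)"
    unfolding xy(3) ..
  then have "mult x (runit y) = mult y (runit y)"
    using runit(2)[OF xy(2)] by (simp add: left_mult_def)
  then have "Some x = Some y"
    using runit(3)[OF xy(1)] runit(3)[OF xy(2)] unfolding eq by metis
  then show "x = y" by simp
qed

lemma left_mult_unit:
  assumes "magma_unit P mult e"
  shows "left_mult e = tid {t \<in> P. lunit t = e}"
proof -
  have "mult e |` P = Some |` {t \<in> P. lunit t = e}"
  proof
    fix t
    show "(mult e |` P) t = (Some |` {t \<in> P. lunit t = e}) t"
    proof (cases "t \<in> P \<and> lunit t = e")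
      case True
      then have "mult e t = Some t" using lunit(3)[of t] by simp
      then show ?thesis using True by simp
    next
      case False
      \<comment> \<open>A defined product would make \<open>e\<close> the left unit of
        \<open>t\<close>.\<close>
      have "mult e t = None" if "t \<in> P"
        using that False assms lunit_unique[of t e] by blast
      then show ?thesis using False by (simp add: restrict_map_def)
    qed
  qed
  then show ?thesis by (simp add: left_mult_def tid_def unit_self(1)[OF assms])
qed

text \<open>Domains and codomains of left multiplications all have this form, with \<open>e\<close>
  a right unit for the domain and a left unit for the codomain.\<close>

lemma tid_in_image:
  assumes "magma_unit P mult e"
  shows "tid {t \<in> P. lunit t = e} \<in> left_mult ` P"
  using left_mult_unit[OF assms] unit_in[OF assms] by (metis imageI)

section \<open>The isomorphism, the action and the transformation poloid\<close>

lemma poloid_iso_left_mult: "poloid_iso P mult (left_mult ` P) tcomp left_mult"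
  using poloid_iso_image[OF poloid_axioms inj_on_left_mult] tcomp_left_mult by blast

lemma poloid_action_left_mult: "poloid_action P mult P left_mult"
proof -
  interpret poloid_iso P mult "left_mult ` P" tcomp left_mult by (rule poloid_iso_left_mult)
  show ?thesis
  proof
    show "left_mult ` P \<subseteq> nonempty_transformations P"
      using left_mult_nonempty_transformation by blast
    show "left_mult e = tid (tdom (left_mult e))" if "magma_unit P mult e" for e
      unfolding tdom_left_mult[OF unit_in[OF that]] unit_self(2)[OF that]
      by (rule left_mult_unit[OF that])
  qed
qed

lemma transformation_poloid_left_mult: "transformation_poloid P (left_mult ` P)"
proof -
  interpret poloid_action P mult P left_mult by (rule poloid_action_left_mult)
  show ?thesis
  proof
    show "left_mult ` P \<subseteq> nonempty_transformations P" by (rule range_transformations)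
    show "tdom f = tcod g"
      if fg: "f \<in> left_mult ` P" "g \<in> left_mult ` P" "tim g \<subseteq> tdom f" for f g
    proof -
      obtain x y where xy: "x \<in> P" "y \<in> P" "f = left_mult x" "g = left_mult y"
        using fg by blast
      \<comment> \<open>Equality of these units turns the defining conditions of the domain and the
        codomain into one another.\<close>
      then have "lunit y = runit x" using fg tim_subset_tdom_iff by blast
      then show ?thesis unfolding xy tdom_left_mult[OF xy(1)] by (simp add: left_mult_def)
    qed
    show "tid (tdom f) \<in> left_mult ` P \<and> tid (tcod f) \<in> left_mult ` P"
      if f: "f \<in> left_mult ` P" for f
    proof -
      obtain x where x: "x \<in> P" "f = left_mult x" using f by blast
      have "tcod f = {t \<in> P. lunit t = lunit x}" by (simp add: x left_mult_def)
      then show ?thesis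
        using x tdom_left_mult tid_in_image lunit(1) runit(1) by metis
    qed
  qed
qed

end

theorem theorem3:
  fixes P :: "'a set" and mult :: "'a \<Rightarrow> 'a \<Rightarrow> 'a option"
  assumes "poloid P mult"
  shows "\<exists>\<alpha> :: 'a \<Rightarrow> 'a transformation.
    poloid_action P mult P \<alpha>
    \<and> poloid_iso P mult (\<alpha> ` P) tcomp \<alpha>
    \<and> transformation_poloid P (\<alpha> ` P)"
proof -
  interpret poloid P mult by fact
  show ?thesis
    using poloid_action_left_mult poloid_iso_left_mult transformation_poloid_left_mult by blast
qed

end
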